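(* Let $p:\mathbb{N}\to[1,+\infty)$ be an exponent function such that $\|\mathbf{1}_{\mathbb{N}}\|_{p(\cdot)}<+\infty$ and let $\sigma\in L^\infty(\mathbb{R})$ be sigmoidal and non-constant. Then $\overline{H_\sigma}=c$, where the closure is taken in the $\|\cdot\|_{p(\cdot)}$ norm.
   Context: $\mathbb{N}=\{1,2,\dots\}$ with counting measure; an exponent function is any function $p:\mathbb{N}\to[1,+\infty)$. For a real sequence $\{x(k)\}$, let $\rho_{p(\cdot)}(\{x(k)\}):=\sum_{j=1}^\infty|x(j)|^{p(j)}$ and $$\|\{x(k)\}\|_{p(\cdot)}=\inf\{\lambda>0:\rho_{p(\cdot)}(\{x(k)\}/\lambda)\le 1\}.$$ The variable sequence space $\ell^{p(\cdot)}$ is the space of sequences with finite norm. $\mathbf{1}_{\mathbb{N}}$ is the constant sequence $1$, and $c$ is the space of convergent real sequences. $H_\sigma$ is the set of sequences $\{y(k)\}$ of the form $y(k)=\sum_{j=1}^M\alpha_j\,\sigma(w_j\cdot k+b_j)$, with $M\in\mathbb{N}$ and $\alpha_j,w_j,b_j\in\mathbb{R}$. A function $\sigma:\mathbb{R}\to\mathbb{R}$ is sigmoidal if the limits $\lim_{t\to+\infty}\sigma(t)$ and $\lim_{t\to-\infty}\sigma(t)$ exist and are finite. *)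

theory Defs
  imports "HOL-Analysis.Analysis"
begin

text \<open>
  The positive integers are represented by \<^typ>\<open>nat\<close> through the shift \<open>n \<mapsto> n + 1\<close>: for a
  sequence \<open>x :: nat \<Rightarrow> real\<close> (or an exponent function), \<open>x n\<close> is the entry with index
  \<open>n + 1 \<in> {1, 2, \<dots>}\<close>. The shift is visible only in \<open>H_set\<close>, the one place where the
  value of an index is used.
\<close>

definition modular :: "(nat \<Rightarrow> real) \<Rightarrow> (nat \<Rightarrow> real) \<Rightarrow> ennreal" where
  "modular p x = (\<Sum>j. ennreal (\<bar>x j\<bar> powr p j))"

text \<open>The infimum is taken in \<^typ>\<open>ennreal\<close>, so that it is \<open>\<infinity>\<close> when no \<open>r\<close> qualifies.\<close>

definition var_norm :: "(nat \<Rightarrow> real) \<Rightarrow> (nat \<Rightarrow> real) \<Rightarrow> ennreal" where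
  "var_norm p x = (INF r \<in> {r::real. 0 < r \<and> modular p (\<lambda>j. x j / r) \<le> 1}. ennreal r)"

definition var_lp :: "(nat \<Rightarrow> real) \<Rightarrow> (nat \<Rightarrow> real) set" where
  "var_lp p = {x. var_norm p x < \<infinity>}"

definition var_dist :: "(nat \<Rightarrow> real) \<Rightarrow> (nat \<Rightarrow> real) \<Rightarrow> (nat \<Rightarrow> real) \<Rightarrow> real" where
  "var_dist p x y = enn2real (var_norm p (\<lambda>j. x j - y j))"

text \<open>
  The norm topology of the variable sequence space; lemma \<open>Metric_space_var_lp\<close> below shows that
  \<open>var_dist p\<close> is a metric there.
\<close>

definition var_topology :: "(nat \<Rightarrow> real) \<Rightarrow> (nat \<Rightarrow> real) topology" where
  "var_topology p = Metric_space.mtopology (var_lp p) (var_dist p)"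

definition H_set :: "(real \<Rightarrow> real) \<Rightarrow> (nat \<Rightarrow> real) set" where
  "H_set \<sigma> = {y. \<exists>(M::nat) (\<alpha>::nat \<Rightarrow> real) (w::nat \<Rightarrow> real) (b::nat \<Rightarrow> real). M \<ge> 1 \<and>
      (\<forall>k. y k = (\<Sum>j=1..M. \<alpha> j * \<sigma> (w j * real (Suc k) + b j)))}"

definition conv_seqs :: "(nat \<Rightarrow> real) set" where
  "conv_seqs = {x. convergent x}"

definition sigmoidal :: "(real \<Rightarrow> real) \<Rightarrow> bool" where
  "sigmoidal \<sigma> \<longleftrightarrow> (\<exists>l. (\<sigma> \<longlongrightarrow> l) at_top) \<and> (\<exists>l. (\<sigma> \<longlongrightarrow> l) at_bot)"

text \<open>
  Membership of the function itself, not of its almost-everywhere class: \<open>H_set\<close> and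
  \<open>sigmoidal\<close> refer to its pointwise values.
\<close>

definition L_infinity :: "(real \<Rightarrow> real) set" where
  "L_infinity = {f \<in> borel_measurable lebesgue. \<exists>C. AE t in lebesgue. \<bar>f t\<bar> \<le> C}"

lemma powr_convex_nonneg:
  fixes a b t p :: real
  assumes "1 \<le> p" "0 \<le> a" "0 \<le> b" "0 \<le> t" "t \<le> 1"
  shows "(t * a + (1 - t) * b) powr p \<le> t * a powr p + (1 - t) * b powr p"
proof -
  have le: "s powr p \<le> s" if "0 \<le> s" "s \<le> 1" for s :: real
    using powr_mono'[of 1 p s] that assms(1) by simp
  consider "a = 0" | "b = 0" | "0 < a" "0 < b" using assms by linarith
  then show ?thesis
  proof cases
    case 1
    then show ?thesis
      using le[of "1 - t"] assms by (simp add: powr_mult mult_right_mono)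
  next
    case 2
    then show ?thesis
      using le[of t] assms by (simp add: powr_mult mult_right_mono)
  next
    case 3
    then show ?thesis
      using convex_onD[OF powr_convex[OF assms(1)], of t b a] assms
      by (simp add: add.commute)
  qed
qed

lemma modular_ge_term: "ennreal (\<bar>x j\<bar> powr p j) \<le> modular p x"
proof -
  have "(\<Sum>i\<in>{j}. ennreal (\<bar>x i\<bar> powr p i)) \<le> (\<Sum>i. ennreal (\<bar>x i\<bar> powr p i))"
    by (rule sum_le_suminf) (rule summableI, rule finite.intros, rule finite.emptyI, rule zero_le)
  then show ?thesis by (simp only: modular_def sum.insert finite.emptyI empty_iff sum.empty add_0_right simp_thms)
qed

lemma var_norm_ge_term:
  assumes "\<And>k. 1 \<le> p k"
  shows "ennreal \<bar>x j\<bar> \<le> var_norm p x"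
  unfolding var_norm_def
proof (rule INF_greatest)
  fix l :: real assume "l \<in> {l. 0 < l \<and> modular p (\<lambda>j. x j / l) \<le> 1}"
  then have l: "0 < l" "modular p (\<lambda>j. x j / l) \<le> 1" by auto
  have "ennreal (\<bar>x j / l\<bar> powr p j) \<le> 1"
    using modular_ge_term[of "\<lambda>j. x j / l" j p] l(2) by (rule order_trans)
  then have "\<bar>x j / l\<bar> powr p j \<le> 1" by (simp add: ennreal_le_1)
  then have "\<bar>x j / l\<bar> \<le> 1"
    using gr_one_powr[of "\<bar>x j / l\<bar>" "p j"] assms[of j] by linarith
  then show "ennreal \<bar>x j\<bar> \<le> ennreal l" using l(1) by (simp add: field_simps ennreal_leI)
qed

lemma var_norm_zero: "var_norm p (\<lambda>_. 0) = 0"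
proof -
  have "var_norm p (\<lambda>_. 0) \<le> ennreal e" if "0 < e" for e
    unfolding var_norm_def by (rule INF_lower) (use that in \<open>simp add: modular_def\<close>)
  then have "var_norm p (\<lambda>_. 0) \<le> 0 + ennreal e" if "0 < e" for e using that by simp
  then have "var_norm p (\<lambda>_. 0) \<le> 0" by (rule ennreal_le_epsilon)
  then show ?thesis by simp
qed

lemma var_norm_uminus: "var_norm p (\<lambda>j. - x j) = var_norm p x"
  by (simp add: var_norm_def modular_def)

lemma modular_convex:
  assumes p: "\<And>k. 1 \<le> p k" and t: "0 \<le> t" "t \<le> 1"
    and x: "modular p x \<le> 1" and y: "modular p y \<le> 1"
  shows "modular p (\<lambda>j. t * x j + (1 - t) * y j) \<le> 1"
proof -
  have "ennreal (\<bar>t * x j + (1 - t) * y j\<bar> powr p j)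
      \<le> ennreal t * ennreal (\<bar>x j\<bar> powr p j) + ennreal (1 - t) * ennreal (\<bar>y j\<bar> powr p j)" for j
  proof -
    have "\<bar>t * x j + (1 - t) * y j\<bar> \<le> t * \<bar>x j\<bar> + (1 - t) * \<bar>y j\<bar>"
      using abs_triangle_ineq[of "t * x j" "(1 - t) * y j"] t by (simp add: abs_mult)
    then have "\<bar>t * x j + (1 - t) * y j\<bar> powr p j \<le> (t * \<bar>x j\<bar> + (1 - t) * \<bar>y j\<bar>) powr p j"
      using p[of j] by (intro powr_mono2) auto
    also have "\<dots> \<le> t * \<bar>x j\<bar> powr p j + (1 - t) * \<bar>y j\<bar> powr p j"
      using p[of j] t by (intro powr_convex_nonneg) auto
    finally show ?thesis
      using t by (simp add: ennreal_leI flip: ennreal_mult ennreal_plus)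
  qed
  then have "modular p (\<lambda>j. t * x j + (1 - t) * y j)
      \<le> (\<Sum>j. ennreal t * ennreal (\<bar>x j\<bar> powr p j) + ennreal (1 - t) * ennreal (\<bar>y j\<bar> powr p j))"
    unfolding modular_def by (intro suminf_le summableI)
  also have "\<dots> = ennreal t * modular p x + ennreal (1 - t) * modular p y"
    unfolding modular_def by (simp add: suminf_add[symmetric] summableI ennreal_suminf_cmult)
  also have "\<dots> \<le> ennreal t * 1 + ennreal (1 - t) * 1"
    using x y by (intro add_mono mult_left_mono) auto
  also have "\<dots> = 1" using t by (simp flip: ennreal_plus)
  finally show ?thesis .
qed

lemma var_norm_triangle:
  assumes p: "\<And>k. 1 \<le> p k"
  shows "var_norm p (\<lambda>j. x j + y j) \<le> var_norm p x + var_norm p y"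
proof -
  let ?S = "\<lambda>x. {l::real. 0 < l \<and> modular p (\<lambda>j. x j / l) \<le> 1}"
  have *: "var_norm p (\<lambda>j. x j + y j) \<le> ennreal l + ennreal m"
    if "l \<in> ?S x" "m \<in> ?S y" for l m
  proof -
    from that have lm: "0 < l" "0 < m" by auto
    have eq: "(x j + y j) / (l + m) = l / (l + m) * (x j / l) + (1 - l / (l + m)) * (y j / m)" for j
    proof -
      have "1 - l / (l + m) = m / (l + m)" using lm by (simp add: field_simps)
      then show ?thesis using lm by (simp add: add_divide_distrib)
    qed
    have "modular p (\<lambda>j. (x j + y j) / (l + m)) \<le> 1"
      unfolding eq by (rule modular_convex[OF p]) (use that in auto)
    then have "var_norm p (\<lambda>j. x j + y j) \<le> ennreal (l + m)"
      unfolding var_norm_def by (intro INF_lower) (use lm in auto)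
    then show ?thesis using lm by simp
  qed
  show ?thesis
  proof (cases "var_norm p x < \<infinity> \<and> var_norm p y < \<infinity>")
    case False
    then show ?thesis by (auto simp: less_top[symmetric])
  next
    case True
    show ?thesis
    proof (rule ennreal_le_epsilon)
      fix e :: real assume e: "0 < e"
      have ex: "\<exists>l\<in>?S z. ennreal l < var_norm p z + ennreal (e / 2)" if "var_norm p z < \<infinity>" for z
      proof -
        have "var_norm p z < var_norm p z + ennreal (e / 2)"
          using that e by (cases "var_norm p z") (auto simp flip: ennreal_plus simp: ennreal_less_iff)
        then show ?thesis by (subst (asm) (1) var_norm_def) (simp add: INF_less_iff)
      qed
      obtain l where l: "l \<in> ?S x" "ennreal l < var_norm p x + ennreal (e / 2)"
        using ex[of x] True by blast
      obtain m where m: "m \<in> ?S y" "ennreal m < var_norm p y + ennreal (e / 2)"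
        using ex[of y] True by blast
      have "var_norm p (\<lambda>j. x j + y j) \<le> ennreal l + ennreal m"
        using l(1) m(1) by (rule *)
      also have "\<dots> \<le> (var_norm p x + ennreal (e / 2)) + (var_norm p y + ennreal (e / 2))"
        using l(2) m(2) by (intro add_mono less_imp_le)
      also have "\<dots> = var_norm p x + var_norm p y + (ennreal (e / 2) + ennreal (e / 2))"
        by (simp add: ac_simps)
      also have "ennreal (e / 2) + ennreal (e / 2) = ennreal e"
        using e by (simp flip: ennreal_plus)
      finally show "var_norm p (\<lambda>j. x j + y j) \<le> var_norm p x + var_norm p y + ennreal e" .
    qed
  qed
qed

lemma var_norm_diff_finite:
  assumes "\<And>k. 1 \<le> p k" "x \<in> var_lp p" "y \<in> var_lp p"
  shows "var_norm p (\<lambda>j. x j - y j) < \<infinity>"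
proof -
  have "var_norm p (\<lambda>j. x j - y j) \<le> var_norm p x + var_norm p y"
    using var_norm_triangle[of p x "\<lambda>j. - y j"] assms(1) by (simp add: var_norm_uminus)
  also have "\<dots> < \<infinity>" using assms by (simp add: var_lp_def)
  finally show ?thesis .
qed

lemma Metric_space_var_lp:
  assumes p: "\<And>k. 1 \<le> p k"
  shows "Metric_space (var_lp p) (var_dist p)"
proof
  fix x y :: "nat \<Rightarrow> real"
  show "0 \<le> var_dist p x y" by (simp add: var_dist_def)
  show "var_dist p x y = var_dist p y x"
    using var_norm_uminus[of p "\<lambda>j. x j - y j"] by (simp add: var_dist_def)
next
  fix x y assume xy: "x \<in> var_lp p" "y \<in> var_lp p"
  show "var_dist p x y = 0 \<longleftrightarrow> x = y"
  proof
    assume "var_dist p x y = 0"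
    then have "var_norm p (\<lambda>j. x j - y j) = 0"
      using var_norm_diff_finite[of p, OF p xy] by (auto simp: var_dist_def enn2real_eq_0_iff)
    then have "ennreal \<bar>x j - y j\<bar> \<le> 0" for j
      using var_norm_ge_term[of p "\<lambda>j. x j - y j" j] p by simp
    then show "x = y" by (auto simp: fun_eq_iff)
  qed (simp add: var_dist_def var_norm_zero)
next
  fix x y z assume xyz: "x \<in> var_lp p" "y \<in> var_lp p" "z \<in> var_lp p"
  note fin = var_norm_diff_finite[of p, OF p xyz(1,2)] var_norm_diff_finite[of p, OF p xyz(2,3)]
  have "var_norm p (\<lambda>j. x j - z j) \<le> var_norm p (\<lambda>j. x j - y j) + var_norm p (\<lambda>j. y j - z j)"
    using var_norm_triangle[of p "\<lambda>j. x j - y j" "\<lambda>j. y j - z j"] p by simp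
  then have "var_dist p x z \<le>
      enn2real (var_norm p (\<lambda>j. x j - y j) + var_norm p (\<lambda>j. y j - z j))"
    unfolding var_dist_def using fin by (intro enn2real_mono) auto
  also have "\<dots> = var_dist p x y + var_dist p y z"
    unfolding var_dist_def using fin by (intro enn2real_plus) auto
  finally show "var_dist p x z \<le> var_dist p x y + var_dist p y z" .
qed

end

theory Submission
  imports Defs
begin

text \<open>
  As \<open>p \<ge> 1\<close> and the constant sequence 1 has finite norm, \<open>var_norm p\<close> is equivalent to the
  supremum norm, so the closure is a uniform closure. Elements of \<open>H_set \<sigma>\<close> converge, and uniform
  limits preserve convergence. Conversely, if \<open>\<sigma> b \<noteq> \<sigma> b'\<close>, then
  \<open>\<sigma> (w (k - n) + b) - \<sigma> (w (k - n) + b')\<close> tends to \<open>(\<sigma> b - \<sigma> b') \<cdot> [k = n]\<close> uniformly in the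
  integer \<open>k\<close> as \<open>w \<rightarrow> \<infinity>\<close>, because \<open>\<sigma>\<close> has limits at both ends. Hence the unit sequences are in the
  closure; together with the constants they span a dense subspace of the convergent sequences.
\<close>

section \<open>Algebraic closure of \<open>H_set\<close> and convergence of its elements\<close>

lemma H_setE:
  assumes "y \<in> H_set \<sigma>"
  obtains M :: nat and a w b :: "nat \<Rightarrow> real" where "M \<ge> 1"
    "y = (\<lambda>k. (\<Sum>j=1..M. a j * \<sigma> (w j * real (Suc k) + b j)))"
proof -
  from assms have "\<exists>(M::nat) (a::nat \<Rightarrow> real) (w::nat \<Rightarrow> real) (b::nat \<Rightarrow> real). M \<ge> 1 \<and> (\<forall>k. y k = (\<Sum>j=1..M. a j * \<sigma> (w j * real (Suc k) + b j)))"
    unfolding H_set_def mem_Collect_eq .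
  then show ?thesis using that by (auto simp: fun_eq_iff)
qed

lemma H_set_atom: "(\<lambda>k. a * \<sigma> (w * real (Suc k) + b)) \<in> H_set \<sigma>"
  unfolding H_set_def
  by (intro CollectI exI[of _ 1] exI[of _ "\<lambda>_. a"] exI[of _ "\<lambda>_. w"] exI[of _ "\<lambda>_. b"]) simp

lemma H_set_add:
  assumes "x \<in> H_set \<sigma>" "y \<in> H_set \<sigma>"
  shows "(\<lambda>k. x k + y k) \<in> H_set \<sigma>"
proof -
  obtain M :: nat and a w b :: "nat \<Rightarrow> real" where M: "M \<ge> 1"
    and x: "x = (\<lambda>k. (\<Sum>j=1..M. a j * \<sigma> (w j * real (Suc k) + b j)))"
    using assms(1) by (rule H_setE)
  obtain M' :: nat and a' w' b' :: "nat \<Rightarrow> real" where M': "M' \<ge> 1"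
    and y: "y = (\<lambda>k. (\<Sum>j=1..M'. a' j * \<sigma> (w' j * real (Suc k) + b' j)))"
    using assms(2) by (rule H_setE)
  \<comment> \<open>Concatenation of two parameter lists: positions up to \<open>M\<close> come from
    the first list. As indices start at 1, position \<open>M + 1\<close> reads entry 1 of the
    second.\<close>
  define c where "c u v j = (if j \<le> M then u j else v (j - M))" for u v :: "nat \<Rightarrow> real" and j :: nat
  have "x k + y k = (\<Sum>j=1..M + M'. c a a' j * \<sigma> (c w w' j * real (Suc k) + c b b' j))" for k
  proof -
    let ?f = "\<lambda>j. c a a' j * \<sigma> (c w w' j * real (Suc k) + c b b' j)"
    have "(\<Sum>j=1..M + M'. ?f j) = (\<Sum>j=1..M. ?f j) + (\<Sum>j=M + 1..M + M'. ?f j)"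
      by (rule sum.ub_add_nat) simp
    also have "(\<Sum>j=1..M. ?f j) = x k"
      unfolding x by (rule sum.cong) (auto simp: c_def)
    also have "(\<Sum>j=M + 1..M + M'. ?f j) = (\<Sum>j=1..M'. ?f (j + M))"
      using sum.shift_bounds_cl_nat_ivl[of ?f 1 M M'] by (simp add: add.commute)
    also have "\<dots> = y k"
      unfolding y by (rule sum.cong) (auto simp: c_def)
    finally show ?thesis by simp
  qed
  then show ?thesis
    using M unfolding H_set_def by (intro CollectI exI[of _ "M + M'"] exI conjI allI) auto
qed

lemma H_set_scale:
  assumes "x \<in> H_set \<sigma>"
  shows "(\<lambda>k. c * x k) \<in> H_set \<sigma>"
proof -
  obtain M :: nat and a w b :: "nat \<Rightarrow> real" where M: "M \<ge> 1"
    and x: "x = (\<lambda>k. (\<Sum>j=1..M. a j * \<sigma> (w j * real (Suc k) + b j)))"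
    using assms by (rule H_setE)
  have "c * x k = (\<Sum>j=1..M. (c * a j) * \<sigma> (w j * real (Suc k) + b j))" for k
    unfolding x by (simp only: sum_distrib_left mult.assoc)
  then show ?thesis
    unfolding H_set_def
    by (intro CollectI exI[of _ M] exI[of _ "\<lambda>j. c * a j"] exI[of _ w] exI[of _ b] conjI M allI)
qed

lemma H_set_sum:
  assumes "finite I" "\<And>i. i \<in> I \<Longrightarrow> f i \<in> H_set \<sigma>"
  shows "(\<lambda>k. \<Sum>i\<in>I. f i k) \<in> H_set \<sigma>"
  using assms
proof (induction I rule: finite_induct)
  case empty
  then show ?case using H_set_atom[of 0] by simp
next
  case (insert i I)
  then show ?case using H_set_add[of "f i" \<sigma> "\<lambda>k. \<Sum>i\<in>I. f i k"] by simp
qed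

text \<open>By linearity it suffices to treat a single atom. According to the sign of
  \<open>w\<close>, its argument is constant or tends to plus or minus infinity, where \<sigma> has
  a limit.\<close>

lemma H_set_convergent:
  assumes "sigmoidal \<sigma>" "y \<in> H_set \<sigma>"
  shows "convergent y"
proof -
  obtain M :: nat and a w b :: "nat \<Rightarrow> real" where "M \<ge> 1"
    and y: "y = (\<lambda>k. (\<Sum>j=1..M. a j * \<sigma> (w j * real (Suc k) + b j)))"
    using assms(2) by (rule H_setE)
  obtain l1 l2 where l: "(\<sigma> \<longlongrightarrow> l1) at_top" "(\<sigma> \<longlongrightarrow> l2) at_bot"
    using assms(1) unfolding sigmoidal_def by blast
  have "convergent (\<lambda>k. \<sigma> (w * real (Suc k) + b))" for w b
  proof -
    have lin: "filterlim (\<lambda>k. real (Suc k)) at_top sequentially"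
      by (intro filterlim_compose[OF filterlim_real_sequentially] filterlim_Suc)
    consider "w = 0" | "w > 0" | "w < 0" by linarith
    then show ?thesis
    proof cases
      case 1
      then show ?thesis by (simp add: convergent_const)
    next
      case 2
      have "filterlim (\<lambda>k. b + w * real (Suc k)) at_top sequentially"
        by (intro filterlim_tendsto_add_at_top[OF tendsto_const]
            filterlim_tendsto_pos_mult_at_top[OF tendsto_const 2 lin])
      then show ?thesis
        using filterlim_compose[OF l(1)] by (auto simp: convergent_def add.commute)
    next
      case 3
      have "filterlim (\<lambda>k. - b + - w * real (Suc k)) at_top sequentially"
        using 3 by (intro filterlim_tendsto_add_at_top[OF tendsto_const]
            filterlim_tendsto_pos_mult_at_top[OF tendsto_const _ lin]) simp
      then have "filterlim (\<lambda>k. w * real (Suc k) + b) at_bot sequentially"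
        by (simp add: filterlim_uminus_at_bot algebra_simps)
      then show ?thesis
        using filterlim_compose[OF l(2)] by (auto simp: convergent_def)
    qed
  qed
  then have "convergent (\<lambda>k. \<Sum>j=1..M. a j * \<sigma> (w j * real (Suc k) + b j))"
    by (intro convergent_sum convergent_mult convergent_const)
  then show ?thesis by (simp add: y)
qed

section \<open>Uniform approximation of convergent sequences\<close>

lemma unit_seq_approx:
  assumes "sigmoidal \<sigma>" "\<not> \<sigma> constant_on UNIV" "0 < e"
  shows "\<exists>h\<in>H_set \<sigma>. \<forall>k. \<bar>h k - (if k = n then 1 else 0)\<bar> \<le> e"
proof -
  obtain b b' where bb: "\<sigma> b \<noteq> \<sigma> b'"
    using assms(2) unfolding constant_on_def by metis
  obtain l1 l2 where l: "(\<sigma> \<longlongrightarrow> l1) at_top" "(\<sigma> \<longlongrightarrow> l2) at_bot"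
    using assms(1) unfolding sigmoidal_def by blast
  define D where "D = \<sigma> b - \<sigma> b'"
  \<comment> \<open>Two values within \<open>d\<close> of a common limit differ by less than
    \<open>2 * d = e * \<bar>D\<bar>\<close>, hence by less than \<open>e\<close> after division by
    \<open>D\<close>.\<close>
  define d where "d = e * \<bar>D\<bar> / 2"
  have D: "D \<noteq> 0" using bb by (simp add: D_def)
  then have d: "d > 0" using assms(3) by (simp add: d_def)
  obtain A where A: "\<And>t. t \<ge> A \<Longrightarrow> \<bar>\<sigma> t - l1\<bar> < d"
    using tendstoD[OF l(1) d] by (auto simp: eventually_at_top_linorder dist_real_def)
  obtain B where B: "\<And>t. t \<le> B \<Longrightarrow> \<bar>\<sigma> t - l2\<bar> < d"
    using tendstoD[OF l(2) d] by (auto simp: eventually_at_bot_linorder dist_real_def)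
  \<comment> \<open>Integers \<open>k \<noteq> n\<close> differ by at least 1, so
    \<open>w * (k - n)\<close> has modulus at least \<open>w\<close>. This carries the argument past
    \<open>A\<close> or \<open>B\<close> even after \<open>b\<close> or \<open>b'\<close> is
    added.\<close>
  define w where "w = \<bar>A\<bar> + \<bar>B\<bar> + \<bar>b\<bar> + \<bar>b'\<bar>"
  \<comment> \<open>The value is that of \<sigma> at \<open>w * (k - n) + c\<close>, written in the
    shape of an atom; the two index shifts cancel. At \<open>k = n\<close> it is exactly
    \<open>\<sigma> c\<close>.\<close>
  define s where "s c k = \<sigma> (w * real (Suc k) + (c - w * real (Suc n)))" for c k
  define h where "h k = 1 / D * s b k + (- 1 / D) * s b' k" for k
  have "h \<in> H_set \<sigma>"
    unfolding h_def[abs_def] s_def by (intro H_set_add H_set_atom)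
  moreover have "\<bar>h k - (if k = n then 1 else 0)\<bar> \<le> e" for k
  proof -
    have h: "h k = (s b k - s b' k) / D" by (simp add: h_def diff_divide_distrib)
    have s: "s c k = \<sigma> (w * (real k - real n) + c)" for c
      by (simp add: s_def algebra_simps)
    have w0: "w \<ge> 0" by (simp add: w_def)
    have wc: "\<bar>A\<bar> + \<bar>B\<bar> + \<bar>c\<bar> \<le> w" if "c \<in> {b, b'}" for c
      using that by (auto simp: w_def)
    have small: ?thesis if "k \<noteq> n" "\<bar>s b k - l\<bar> < d" "\<bar>s b' k - l\<bar> < d" for l
    proof -
      have "\<bar>s b k - s b' k\<bar> \<le> e * \<bar>D\<bar>" using that(2,3) unfolding d_def by linarith
      then show ?thesis using D that(1) by (simp add: h divide_le_eq)
    qed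
    consider "k = n" | "k > n" | "k < n" by linarith
    then show ?thesis
    proof cases
      case 1
      then have "s b k - s b' k = D" by (simp add: s_def D_def)
      then have "h k = 1" using D by (simp add: h)
      then show ?thesis using 1 assms(3) by simp
    next
      case 2
      then have "w \<le> w * (real k - real n)"
        using mult_left_mono[of 1 "real k - real n" w] w0 by simp
      then have "A \<le> w * (real k - real n) + c" if "c \<in> {b, b'}" for c
        using wc[OF that] by linarith
      then show ?thesis
        using 2 by (intro small[of l1]) (simp_all add: s A)
    next
      case 3
      then have "w * (real k - real n) \<le> - w"
        using mult_left_mono[of "real k - real n" "-1" w] w0 by simp
      then have "w * (real k - real n) + c \<le> B" if "c \<in> {b, b'}" for c
        using wc[OF that] by linarith
      then show ?thesis
        using 3 by (intro small[of l2]) (simp_all add: s B)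
    qed
  qed
  ultimately show ?thesis by blast
qed

text \<open>Up to a tail of size \<open>e / 2\<close>, \<open>x\<close> is its limit
  \<open>l\<close> plus finitely many multiples of unit sequences. Replacing these unit sequences by
  elements of \<open>H_set\<close> costs another \<open>e / 2\<close>.\<close>

lemma convergent_approx:
  assumes "sigmoidal \<sigma>" "\<not> \<sigma> constant_on UNIV" "convergent x" "0 < e"
  shows "\<exists>h\<in>H_set \<sigma>. \<forall>k. \<bar>x k - h k\<bar> \<le> e"
proof -
  obtain l where "x \<longlonglongrightarrow> l" using assms(3) by (auto simp: convergent_def)
  from LIMSEQ_D[OF this, of "e / 2"] assms(4)
  obtain N where N: "\<And>k. k \<ge> N \<Longrightarrow> \<bar>x k - l\<bar> < e / 2" by auto
  \<comment> \<open>An atom with \<open>w = 0\<close> and \<open>b = t\<close> is a nonzero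
    constant, so constant sequences lie in \<open>H_set\<close> exactly.\<close>
  obtain t where t: "\<sigma> t \<noteq> 0"
    using assms(2) unfolding constant_on_def by auto
  define S where "S = (\<Sum>n<N. \<bar>x n - l\<bar>)"
  have S: "S \<ge> 0" by (simp add: S_def sum_nonneg)
  \<comment> \<open>The errors, weighted by the coefficients, add up to at most
    \<open>S * d \<le> e / 2\<close>; the 1 in the denominator covers \<open>S = 0\<close>.\<close>
  define d where "d = e / 2 / (S + 1)"
  have d: "d > 0" using S assms(4) by (simp add: d_def)
  obtain g where g: "\<And>n. g n \<in> H_set \<sigma>"
    and gd: "\<And>n k. \<bar>g n k - (if k = n then 1 else 0)\<bar> \<le> d"
    using unit_seq_approx[OF assms(1,2) d] by metis
  define h where "h k = l / \<sigma> t * \<sigma> (0 * real (Suc k) + t) + (\<Sum>n<N. (x n - l) * g n k)" for k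
  have "h \<in> H_set \<sigma>"
    unfolding h_def[abs_def] by (intro H_set_add H_set_atom H_set_sum H_set_scale g) simp
  moreover have "\<bar>x k - h k\<bar> \<le> e" for k
  proof -
    have "(\<Sum>n<N. (x n - l) * (if k = n then 1 else 0)) = (if k < N then x k - l else 0)"
      by (simp add: if_distrib cong: if_cong)
    \<comment> \<open>The remainder vanishes for \<open>k < N\<close> and equals
      \<open>x k - l\<close> beyond.\<close>
    then have "\<bar>x k - l - (\<Sum>n<N. (x n - l) * (if k = n then 1 else 0))\<bar> \<le> e / 2"
      using N[of k] assms(4) by auto
    moreover have "\<bar>\<Sum>n<N. (x n - l) * (g n k - (if k = n then 1 else 0))\<bar> \<le> e / 2"
    proof -
      have "\<bar>\<Sum>n<N. (x n - l) * (g n k - (if k = n then 1 else 0))\<bar> \<le> (\<Sum>n<N. \<bar>x n - l\<bar> * d)"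
        by (intro order_trans[OF sum_abs] sum_mono)
          (simp only: abs_mult mult_left_mono[OF gd] abs_ge_zero)
      also have "\<dots> = S * d" by (simp add: S_def sum_distrib_right)
      also have "\<dots> \<le> e / 2" using S assms(4) by (simp add: d_def field_simps)
      finally show ?thesis .
    qed
    moreover have "x k - h k = x k - l - (\<Sum>n<N. (x n - l) * (if k = n then 1 else 0))
        - (\<Sum>n<N. (x n - l) * (g n k - (if k = n then 1 else 0)))"
      using t by (simp add: h_def right_diff_distrib sum_subtractf)
    ultimately show ?thesis by linarith
  qed
  ultimately show ?thesis by blast
qed

section \<open>Uniform limits and comparison with the supremum norm\<close>

lemma convergent_uniform_limit:
  fixes x :: "nat \<Rightarrow> real"
  assumes "\<And>e. 0 < e \<Longrightarrow> \<exists>y. convergent y \<and> (\<forall>k. \<bar>x k - y k\<bar> < e)"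
  shows "convergent x"
  unfolding Cauchy_convergent_iff[symmetric]
proof (rule metric_CauchyI)
  fix e :: real assume "0 < e"
  then obtain y where "convergent y" and y: "\<And>k. \<bar>x k - y k\<bar> < e / 3"
    using assms[of "e / 3"] by auto
  then obtain N where N: "\<And>m n. m \<ge> N \<Longrightarrow> n \<ge> N \<Longrightarrow> \<bar>y m - y n\<bar> < e / 3"
    using metric_CauchyD[OF convergent_Cauchy, of y "e / 3"] \<open>0 < e\<close> by (auto simp: dist_real_def)
  have "dist (x m) (x n) < e" if "m \<ge> N" "n \<ge> N" for m n
    using N[OF that] y[of m] y[of n] unfolding dist_real_def by argo
  then show "\<exists>M. \<forall>m\<ge>M. \<forall>n\<ge>M. dist (x m) (x n) < e" by blast
qed

text \<open>If \<open>r\<close> is admissible in the infimum for the constant 1, then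
  \<open>C * r\<close> is admissible for every \<open>x\<close> bounded by \<open>C\<close>, because
  powers with nonnegative exponent are monotone. The reverse comparison is
  \<open>var_norm_ge_term\<close>.\<close>

lemma var_norm_le_sup:
  assumes "\<And>k. 1 \<le> p k" "var_norm p (\<lambda>_. 1) < \<infinity>"
  obtains r where "0 < r" "\<And>x C. 0 < C \<Longrightarrow> (\<And>k. \<bar>x k\<bar> \<le> C) \<Longrightarrow> var_norm p x \<le> ennreal (C * r)"
proof -
  obtain r where r: "0 < r" "modular p (\<lambda>_. 1 / r) \<le> 1"
    using assms(2) unfolding var_norm_def by (auto simp: INF_less_iff)
  have "var_norm p x \<le> ennreal (C * r)" if C: "0 < C" and x: "\<And>k. \<bar>x k\<bar> \<le> C" for x C
  proof -
    have "\<bar>x k / (C * r)\<bar> \<le> \<bar>1 / r\<bar>" for k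
      using x[of k] C r(1) by (simp add: abs_mult field_simps)
    then have "modular p (\<lambda>k. x k / (C * r)) \<le> modular p (\<lambda>_. 1 / r)"
      unfolding modular_def using assms(1)
      by (intro suminf_le summableI ennreal_leI powr_mono2) (auto intro: order_trans[of 0 1])
    then show ?thesis
      unfolding var_norm_def using r C by (intro INF_lower) auto
  qed
  with r(1) show ?thesis by (rule that)
qed

theorem proposition5p7:
  fixes p :: "nat \<Rightarrow> real" and \<sigma> :: "real \<Rightarrow> real"
  assumes "\<And>k. 1 \<le> p k"
    and "var_norm p (\<lambda>_. 1) < \<infinity>"
    and "\<sigma> \<in> L_infinity"
    and "sigmoidal \<sigma>"
    and "\<not> \<sigma> constant_on UNIV"
  shows "var_topology p closure_of H_set \<sigma> = conv_seqs"
proof -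
  interpret Metric_space "var_lp p" "var_dist p"
    by (rule Metric_space_var_lp) (rule assms(1))
  obtain r where r: "0 < r"
    and le: "\<And>x C. 0 < C \<Longrightarrow> (\<And>k. \<bar>x k\<bar> \<le> C) \<Longrightarrow> var_norm p x \<le> ennreal (C * r)"
    using var_norm_le_sup[of p] assms(1,2) by blast
  \<comment> \<open>Convergent sequences are bounded. Membership in the carrier must be known before
    a sequence can belong to a metric ball or to the closure.\<close>
  have conv: "x \<in> var_lp p" if x: "convergent x" for x
  proof -
    obtain C where "0 < C" "\<And>k. \<bar>x k\<bar> \<le> C"
      using convergent_imp_Bseq[OF x] by (auto elim: BseqE)
    then have "var_norm p x \<le> ennreal (C * r)" by (rule le)
    then show ?thesis by (simp add: var_lp_def le_less_trans)
  qed
  \<comment> \<open>Passing from \<open>ennreal\<close> to reals preserves the inequality because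
    the norm of the difference is finite; \<open>enn2real\<close> would send an infinite norm to
    0.\<close>
  have ge: "\<bar>x k - y k\<bar> \<le> var_dist p x y" if "x \<in> var_lp p" "y \<in> var_lp p" for x y k
  proof -
    have "ennreal \<bar>x k - y k\<bar> \<le> var_norm p (\<lambda>j. x j - y j)"
      using var_norm_ge_term[of p "\<lambda>j. x j - y j" k] assms(1) by simp
    from enn2real_mono[OF this] show ?thesis
      using var_norm_diff_finite[of p x y] assms(1) that by (simp add: var_dist_def)
  qed
  have "x \<in> mtopology closure_of H_set \<sigma> \<longleftrightarrow> convergent x" for x
  proof
    assume "x \<in> mtopology closure_of H_set \<sigma>"
    then have x: "x \<in> var_lp p" "\<And>e. 0 < e \<Longrightarrow> \<exists>y\<in>H_set \<sigma>. y \<in> mball x e"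
      by (auto simp: metric_closure_of)
    show "convergent x"
    proof (rule convergent_uniform_limit)
      fix e :: real assume "0 < e"
      then obtain y where "y \<in> H_set \<sigma>" "y \<in> mball x e" using x(2) by blast
      then show "\<exists>y. convergent y \<and> (\<forall>k. \<bar>x k - y k\<bar> < e)"
        using H_set_convergent[OF assms(4)] ge[of x y] by (auto intro: le_less_trans)
    qed
  next
    assume x: "convergent x"
    have "\<exists>y\<in>H_set \<sigma>. y \<in> mball x e" if e: "0 < e" for e
    proof -
      \<comment> \<open>Multiplication by \<open>r\<close> turns this uniform error into
        \<open>e / 2\<close>, leaving room for the strict inequality of the open ball.\<close>
      have pos: "0 < e / (2 * r)" using e r by simp
      obtain h where h: "h \<in> H_set \<sigma>" "\<And>k. \<bar>x k - h k\<bar> \<le> e / (2 * r)"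
        using convergent_approx[OF assms(4,5) x pos] by blast
      have "var_norm p (\<lambda>k. x k - h k) \<le> ennreal (e / 2)"
        using le[OF pos h(2)] r by simp
      from enn2real_mono[OF this] have "var_dist p x h < e"
        using e by (simp add: var_dist_def)
      then show ?thesis
        using h(1) conv[OF x] conv[OF H_set_convergent[OF assms(4) h(1)]] by auto
    qed
    then show "x \<in> mtopology closure_of H_set \<sigma>"
      using conv[OF x] by (simp add: metric_closure_of)
  qed
  then show ?thesis by (auto simp: var_topology_def conv_seqs_def)
qed

end
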